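(* Let $\gamma,\theta\in(0,1)$. (a) (Local convergence.) Let $y_0\in\mathcal Y_{\mathrm{adm}}$ satisfy $$r(y_0)<(1-\gamma)\frac{y_{\min}^2}{L^2\operatorname{tr}\hat Y},$$ and suppose that, for each $k$ (as long as $y_k\ne\hat y$), with $b_k:=\nabla\operatorname{tr}F(y_k)$, the next iterate $y_{k+1}\in\mathcal Y_{\mathrm{adm}}$ is chosen such that $$b_k^T(y_{k+1}-y_k)\ge\theta(\overline z_k-b_k^Ty_k)\quad\text{for some } \overline z_k\ge\max_{w\in\mathcal Y_{\mathrm{adm}}}b_k^Tw.$$ Then either $y_k=\hat y$ after finitely many steps, or one obtains a sequence $(y_k)_{k\in\mathbb N_0}$ with $r(y_k)\to0$, $$\sup_{k\in\mathbb N}\frac{r(y_{k+1})}{r(y_k)}\le1-\theta\gamma<1\quad\text{and}\quad\limsup_{k\to\infty}\frac{r(y_{k+1})}{r(y_k)}\le1-\theta<1,$$ and $y_k\to\hat y$ linearly (i.e. $\|y_k-\hat y\|_\infty$ is bounded by a geometrically decaying sequence). (b) (Global convergence.) Choose $\kappa$ with $1-\theta\gamma<\kappa<1$ and let $y_0\in\mathcal Y_{\mathrm{adm}}$ be arbitrary. Consider the globalized method described in the context, and assume that all its subroutine calls (SDP solver and global search) terminate in finitely many steps. Then either the method reaches $y_k=\hat y$ after finitely many steps, or it yields a sequence with linear convergence $r(y_k)\to0$ and $y_k\to\hat y$ (both bounded by geometrically decaying sequences), and only finitely many iterations require global search steps.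
   Context: Let $l,n,m\in\mathbb N$. $\mathbb S^k$, $\mathbb S^k_+$, $\mathbb S^k_{++}$ denote the real symmetric, positive semidefinite, positive definite $k\times k$ matrices; $\succeq$ is the Loewner order; $\|\cdot\|_2$ is the spectral norm for matrices. Inequalities between vectors are componentwise, $[y^-,y^+]=\{y\in\mathbb R^m: y^-\le y\le y^+\}$, $\mathbf 1$ is the all-ones vector, $\mathbb R^m_{++}=(0,\infty)^m$. Let $0\ne A_i\in\mathbb S^n_+$ ($i=1,\dots,m$), $A_y:=\sum_{j=1}^m y_jA_j$ for $y\in\mathbb R^m$, assume $A_{\mathbf 1}\succ0$, and let $B\in\mathbb R^{l\times n}$ have full row rank. Define $F:\mathbb R^m_{++}\to\mathbb S^l$, $F(y)=BA_y^{-1}B^T$. Let $y^\pm\in\mathbb R^m$ with $y^+>y^->0$, $\delta>0$, $\hat y\in[y^-+\delta\mathbf 1,y^+-\delta\mathbf 1]$, and $\hat Y:=F(\hat y)\in\mathbb S^l_{++}$. Assume there is $L>0$ with $\|y-z\|_\infty\le L\|F(y)-F(z)\|_2$ for all $y,z\in[y^-,y^+]$. Let $\mathcal Y_{\mathrm{adm}}:=\{y\in[y^-,y^+]: F(y)\preceq\hat Y\}$, $r(y):=\operatorname{tr}(\hat Y-F(y))$, $y_{\min}:=\min_i y^-_i$. $\nabla\operatorname{tr}F(y)\in\mathbb R^m$ has entries $-\operatorname{tr}(BA_y^{-1}A_iA_y^{-1}B^T)$. Globalized method for (b). In step $k$, if $y_k=\hat y$ the method stops. Otherwise set $b_k:=\nabla\operatorname{tr}F(y_k)$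 and run an SDP solver for $\max_{w\in\mathcal Y_{\mathrm{adm}}}b_k^Tw$ which maintains upper bounds $\overline z\ge\max_{w\in\mathcal Y_{\mathrm{adm}}}b_k^Tw$. It stops either by returning a candidate $y_{k+1}^{\mathrm{cand}}\in\mathcal Y_{\mathrm{adm}}$ with $b_k^T(y_{k+1}^{\mathrm{cand}}-y_k)\ge\theta(\overline z-b_k^Ty_k)$ for its current upper bound $\overline z$, or by reporting failure, which it does only if its current upper bound $\overline z$ violates the criterion $\overline z-b_k^Ty_k\ge\gamma r(y_k)$. If no failure is reported and $r(y_{k+1}^{\mathrm{cand}})\le\kappa r(y_k)$, set $y_{k+1}:=y_{k+1}^{\mathrm{cand}}$. Otherwise (failure, or this inequality is violated) a global search step is used to find $y_{k+1}\in\mathcal Y_{\mathrm{adm}}$ with $r(y_{k+1})\le\kappa r(y_k)$. *)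

theory Defs
  imports "HOL-Analysis.Analysis"
begin

definition psd :: "real^'k^'k \<Rightarrow> bool" where
  "psd M \<longleftrightarrow> transpose M = M \<and> (\<forall>x. 0 \<le> x \<bullet> (M *v x))"

definition pos_def :: "real^'k^'k \<Rightarrow> bool" where
  "pos_def M \<longleftrightarrow> transpose M = M \<and> (\<forall>x. x \<noteq> 0 \<longrightarrow> 0 < x \<bullet> (M *v x))"

definition loewner_le :: "real^'k^'k \<Rightarrow> real^'k^'k \<Rightarrow> bool"  (infix "\<preceq>" 50) where
  "X \<preceq> Y \<longleftrightarrow> psd (Y - X)"

definition spectral_norm :: "real^'k^'k \<Rightarrow> real" where
  "spectral_norm M = onorm (\<lambda>x. M *v x)"

definition lin_comb :: "('m::finite \<Rightarrow> real^'n^'n) \<Rightarrow> real^'m \<Rightarrow> real^'n^'n" where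
  "lin_comb A y = (\<Sum>j\<in>UNIV. (y $ j) *\<^sub>R A j)"

text \<open>Only used for componentwise positive \<open>y\<close>, where \<open>lin_comb A y\<close> is positive definite,
  so that \<open>matrix_inv\<close> is the genuine inverse.\<close>

definition F :: "('m::finite \<Rightarrow> real^'n^'n) \<Rightarrow> real^'n^'l \<Rightarrow> real^'m \<Rightarrow> real^'l^'l" where
  "F A B y = B ** matrix_inv (lin_comb A y) ** transpose B"

text \<open>The gradient of \<open>\<lambda>y. trace (F A B y)\<close>; the entries come from
  \<open>\<partial>\<^sub>i (A\<^sub>y\<^sup>-\<^sup>1) = - A\<^sub>y\<^sup>-\<^sup>1 A\<^sub>i A\<^sub>y\<^sup>-\<^sup>1\<close>.\<close>

definition grad_trace_F :: "('m::finite \<Rightarrow> real^'n^'n) \<Rightarrow> real^'n^'l \<Rightarrow> real^'m \<Rightarrow> real^'m" where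
  "grad_trace_F A B y =
     (\<chi> i. - trace (B ** matrix_inv (lin_comb A y) ** A i ** matrix_inv (lin_comb A y) ** transpose B))"

definition adm :: "('m::finite \<Rightarrow> real^'n^'n) \<Rightarrow> real^'n^'l \<Rightarrow> real^'m \<Rightarrow> real^'m \<Rightarrow> real^'m
    \<Rightarrow> (real^'m) set" where
  "adm A B ylo yup yhat = {y \<in> {ylo..yup}. F A B y \<preceq> F A B yhat}"

definition res :: "('m::finite \<Rightarrow> real^'n^'n) \<Rightarrow> real^'n^'l \<Rightarrow> real^'m \<Rightarrow> real^'m \<Rightarrow> real" where
  "res A B yhat y = trace (F A B yhat - F A B y)"

definition geometrically_bounded :: "(nat \<Rightarrow> real) \<Rightarrow> bool" where
  "geometrically_bounded a \<longleftrightarrow> (\<exists>C q. 0 < q \<and> q < 1 \<and> (\<forall>k. \<bar>a k\<bar> \<le> C * q ^ k))"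

text \<open>\<open>sdp_upper_bound Y b z\<close> says that \<open>z\<close> is at least the maximum of \<open>\<lambda>w. b \<bullet> w\<close> over \<open>Y\<close>.\<close>

definition sdp_upper_bound :: "(real^'m) set \<Rightarrow> real^'m \<Rightarrow> real \<Rightarrow> bool" where
  "sdp_upper_bound Y b z \<longleftrightarrow> (\<forall>w\<in>Y. b \<bullet> w \<le> z)"

text \<open>\<open>sdp_outcome Y b \<gamma> \<theta> \<rho> yk z out\<close> describes a finished run of the SDP solver at the iterate
  \<open>yk\<close> with residual \<open>\<rho>\<close>: \<open>z\<close> is the upper bound held by the solver when it stops, and \<open>out\<close> is
  \<open>Some c\<close> if the candidate \<open>c\<close> is returned and \<open>None\<close> if failure is reported.\<close>

definition sdp_outcome :: "(real^'m) set \<Rightarrow> real^'m \<Rightarrow> real \<Rightarrow> real \<Rightarrow> real \<Rightarrow> real^'m \<Rightarrow> real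
    \<Rightarrow> (real^'m) option \<Rightarrow> bool" where
  "sdp_outcome Y b \<gamma> \<theta> \<rho> yk z out \<longleftrightarrow>
     sdp_upper_bound Y b z \<and>
     (case out of
        Some c \<Rightarrow> c \<in> Y \<and> b \<bullet> (c - yk) \<ge> \<theta> * (z - b \<bullet> yk)
      | None \<Rightarrow> \<not> (z - b \<bullet> yk \<ge> \<gamma> * \<rho>))"

definition needs_global_search :: "(real^'m \<Rightarrow> real) \<Rightarrow> real \<Rightarrow> real^'m \<Rightarrow> (real^'m) option \<Rightarrow> bool" where
  "needs_global_search r \<kappa> yk out \<longleftrightarrow>
     (case out of Some c \<Rightarrow> \<not> (r c \<le> \<kappa> * r yk) | None \<Rightarrow> True)"

text \<open>A run of the globalized method in which every subroutine call terminates: \<open>y\<close> are the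
  iterates, \<open>z\<close> and \<open>out\<close> the final upper bounds and outputs of the SDP solver. If the method
  stops because \<open>y k = yhat\<close>, the later values of the three sequences carry no meaning
  and are not used.\<close>

definition globalized_run :: "('m::finite \<Rightarrow> real^'n^'n) \<Rightarrow> real^'n^'l \<Rightarrow> real^'m \<Rightarrow> real^'m \<Rightarrow> real^'m
    \<Rightarrow> real \<Rightarrow> real \<Rightarrow> real \<Rightarrow> (nat \<Rightarrow> real^'m) \<Rightarrow> (nat \<Rightarrow> real) \<Rightarrow> (nat \<Rightarrow> (real^'m) option) \<Rightarrow> bool" where
  "globalized_run A B ylo yup yhat \<gamma> \<theta> \<kappa> y z out \<longleftrightarrow>
     y 0 \<in> adm A B ylo yup yhat \<and>
     (\<forall>k. (\<forall>j\<le>k. y j \<noteq> yhat) \<longrightarrow>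
        sdp_outcome (adm A B ylo yup yhat) (grad_trace_F A B (y k)) \<gamma> \<theta> (res A B yhat (y k))
          (y k) (z k) (out k) \<and>
        (if needs_global_search (res A B yhat) \<kappa> (y k) (out k)
         then y (Suc k) \<in> adm A B ylo yup yhat \<and> res A B yhat (y (Suc k)) \<le> \<kappa> * res A B yhat (y k)
         else y (Suc k) = the (out k)))"

end

theory Submission
  imports Defs
begin

text \<open>Write \<open>r\<close> for the residual and \<open>b\<close> for the gradient of \<open>tr F\<close> at \<open>y\<close>. The Taylor remainder
  \<open>tr F(z) - tr F(y) - b \<bullet> (z - y)\<close> is a sum of quadratic forms \<open>w \<bullet> A\<^sub>z w\<close>, hence nonnegative, and
  arithmetic-geometric mean bounds it by \<open>t\<^sup>2 tr F(y)\<close> whenever \<open>\<bar>z - y\<bar> \<le> t y\<close> and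
  \<open>\<bar>z - y\<bar> \<le> t z\<close> componentwise. For \<open>z = yhat\<close>, the stability estimate
  \<open>infnorm (y - yhat) \<le> L r(y)\<close> allows \<open>t = L r(y) / ymin\<close>, so that
  \<open>b \<bullet> (yhat - y) \<ge> r(y) (1 - c r(y))\<close> with \<open>c = L\<^sup>2 tr F(yhat) / ymin\<^sup>2\<close>. Convexity turns this gain
  into the contraction \<open>r(y') \<le> (1 - \<theta> (1 - c r(y))) r(y)\<close> for every candidate \<open>y'\<close>. The threshold on
  \<open>r(y\<^sub>0)\<close> says \<open>c r(y\<^sub>0) < 1 - \<gamma>\<close>; the globalized method decreases \<open>r\<close> by the factor \<open>\<kappa>\<close> in every
  step and therefore eventually satisfies the same condition, after which neither failure nor
  rejection of a candidate is possible.\<close>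

section \<open>Quadratic forms and traces of semidefinite matrices\<close>

lemma symmetric_inner:
  fixes M :: "real^'k^'k"
  assumes "transpose M = M"
  shows "x \<bullet> (M *v y) = y \<bullet> (M *v x)"
  by (metis assms dot_lmul_matrix inner_commute transpose_matrix_vector)

lemma psd_inner_nonneg: "psd M \<Longrightarrow> 0 \<le> x \<bullet> (M *v x)"
  by (simp add: psd_def)

lemma psd_symmetric: "psd M \<Longrightarrow> x \<bullet> (M *v y) = y \<bullet> (M *v x)"
  by (simp add: psd_def symmetric_inner)

text \<open>The quadratic polynomial \<open>s \<mapsto> (x + s y) \<bullet> M (x + s y)\<close> is
  nonnegative, so its discriminant is not positive. The leading coefficient may vanish, hence the
  case split.\<close>

lemma psd_Cauchy_Schwarz:
  assumes M: "psd M"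
  shows "(x \<bullet> (M *v y))\<^sup>2 \<le> (x \<bullet> (M *v x)) * (y \<bullet> (M *v y))"
proof -
  define a b c where "a = x \<bullet> (M *v x)" and "b = x \<bullet> (M *v y)" and "c = y \<bullet> (M *v y)"
  have pos: "0 \<le> a + 2 * s * b + s\<^sup>2 * c" for s
  proof -
    have "0 \<le> (x + s *\<^sub>R y) \<bullet> (M *v (x + s *\<^sub>R y))"
      by (rule psd_inner_nonneg[OF M])
    also have "\<dots> = a + 2 * s * b + s\<^sup>2 * c"
      using psd_symmetric[OF M, of y x]
      by (simp add: a_def b_def c_def matrix_vector_right_distrib matrix_vector_mult_scaleR
          inner_add_left inner_add_right algebra_simps power2_eq_square)
    finally show ?thesis .
  qed
  have c0: "0 \<le> c" unfolding c_def by (rule psd_inner_nonneg[OF M])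
  have "b\<^sup>2 \<le> a * c"
  proof (cases "c = 0")
    case True
    have "b = 0"
    proof (rule ccontr)
      assume "b \<noteq> 0"
      then show False
        \<comment> \<open>With \<open>c = 0\<close> the polynomial is affine, and at this
          \<open>s\<close> it equals -1.\<close>
        using pos[of "- (a + 1) / (2 * b)"] True by (simp add: field_simps)
    qed
    then show ?thesis using True by simp
  next
    case False
    then show ?thesis
      \<comment> \<open>The minimizer of the quadratic.\<close>
      using pos[of "- b / c"] c0 by (simp add: field_simps power2_eq_square)
  qed
  then show ?thesis by (simp add: a_def b_def c_def)
qed

lemma inner_matrix_axis: "axis i 1 \<bullet> ((M :: real^'k^'k) *v axis j 1) = M $ i $ j"
  by (simp add: inner_axis' matrix_vector_mult_basis column_def)

lemma psd_trace_nonneg: "psd M \<Longrightarrow> 0 \<le> trace M"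
  unfolding trace_def
  by (rule sum_nonneg) (metis inner_matrix_axis psd_inner_nonneg)

text \<open>The Frobenius norm lies in between: it bounds the spectral norm by Cauchy-Schwarz on
  rows, and \<open>M $ i $ j\<close> squared is at most \<open>M $ i $ i * M $ j $ j\<close>, whose
  double sum is the squared trace. This avoids eigenvalues.\<close>

lemma spectral_norm_le_trace:
  fixes M :: "real^'k^'k"
  assumes M: "psd M"
  shows "spectral_norm M \<le> trace M"
proof -
  have "norm (M *v x) \<le> trace M * norm x" for x
  proof -
    have "(norm (M *v x))\<^sup>2 = (\<Sum>i\<in>UNIV. (M $ i \<bullet> x)\<^sup>2)"
      by (simp add: norm_vec_def L2_set_def sum_nonneg matrix_vector_mul_component)
    also have "\<dots> \<le> (\<Sum>i\<in>UNIV. (M $ i \<bullet> M $ i) * (x \<bullet> x))"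
      by (intro sum_mono Cauchy_Schwarz_ineq)
    also have "\<dots> = (\<Sum>i\<in>UNIV. \<Sum>j\<in>UNIV. (M $ i $ j)\<^sup>2) * (x \<bullet> x)"
      by (simp add: inner_vec_def sum_distrib_right power2_eq_square)
    also have "\<dots> \<le> (\<Sum>i\<in>UNIV. \<Sum>j\<in>UNIV. M $ i $ i * M $ j $ j) * (x \<bullet> x)"
      using psd_Cauchy_Schwarz[OF M, of "axis _ 1" "axis _ 1"]
      by (intro mult_right_mono sum_mono) (simp_all add: inner_matrix_axis)
    also have "\<dots> = (trace M * norm x)\<^sup>2"
      by (simp add: trace_def sum_product power_mult_distrib power2_norm_eq_inner)
        (simp add: power2_eq_square sum_product)
    finally show ?thesis
      using psd_trace_nonneg[OF M] by (simp add: power2_le_iff_abs_le)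
  qed
  then show ?thesis
    unfolding spectral_norm_def by (intro onorm_bound psd_trace_nonneg M) auto
qed

section \<open>Linear combinations, congruences and inverses\<close>

lemma lin_comb_mult: "lin_comb A y *v x = (\<Sum>i\<in>UNIV. y $ i *\<^sub>R (A i *v x))"
proof -
  have "finite S \<Longrightarrow> (\<Sum>i\<in>S. y $ i *\<^sub>R A i) *v x = (\<Sum>i\<in>S. y $ i *\<^sub>R (A i *v x))" for S
    by (induction S rule: finite_induct)
      (simp_all add: matrix_vector_mult_add_rdistrib scaleR_matrix_vector_assoc)
  then show ?thesis by (simp add: lin_comb_def)
qed

lemma lin_comb_inner: "w \<bullet> (lin_comb A y *v x) = (\<Sum>i\<in>UNIV. y $ i * (w \<bullet> (A i *v x)))"
  by (simp add: lin_comb_mult inner_sum_right)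

lemma lin_comb_diff: "lin_comb A (y - z) = lin_comb A y - lin_comb A z"
  by (simp add: lin_comb_def scaleR_left_diff_distrib sum_subtractf)

text \<open>Reduces traces of \<open>F\<close> and of its derivative to scalar quadratic forms at
  the rows of \<open>B\<close>.\<close>

lemma trace_congruence:
  fixes B :: "real^'n^'l"
  shows "trace (B ** M ** transpose B) = (\<Sum>i\<in>UNIV. row i B \<bullet> (M *v row i B))"
proof -
  have "(B ** M ** transpose B) $ i $ i = row i B \<bullet> (M *v row i B)" for i
  proof -
    have "(B ** M ** transpose B) $ i $ i = (\<Sum>k\<in>UNIV. \<Sum>j\<in>UNIV. B $ i $ j * M $ j $ k * B $ i $ k)"
      by (simp add: matrix_matrix_mult_def transpose_def sum_distrib_right)
    also have "\<dots> = (\<Sum>j\<in>UNIV. \<Sum>k\<in>UNIV. B $ i $ j * M $ j $ k * B $ i $ k)"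
      by (rule sum.swap)
    also have "\<dots> = row i B \<bullet> (M *v row i B)"
      by (simp add: inner_vec_def row_def matrix_vector_mult_def sum_distrib_left mult.assoc)
    finally show ?thesis .
  qed
  then show ?thesis by (simp add: trace_def)
qed

lemma pos_def_inverse:
  fixes M :: "real^'k^'k"
  assumes "pos_def M"
  shows "M *v (matrix_inv M *v u) = u"
proof -
  have "M *v x = 0 \<Longrightarrow> x = 0" for x
    using assms by (metis inner_zero_right less_irrefl pos_def_def)
  then have "\<exists>M'. M ** M' = mat 1 \<and> M' ** M = mat 1"
    by (metis matrix_left_invertible_ker invertible_left_inverse invertible_def)
  then have "M ** matrix_inv M = mat 1 \<and> matrix_inv M ** M = mat 1"
    unfolding matrix_inv_def by (rule someI_ex)
  then show ?thesis
    by (simp add: matrix_vector_mul_assoc)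
qed

text \<open>The left-hand side of the second equation is the first-order Taylor remainder of
  \<open>X \<mapsto> u \<bullet> X\<^sup>-\<^sup>1 u\<close> at \<open>M\<close>, evaluated at \<open>N\<close>.\<close>

lemma inverse_form_remainder:
  fixes M N :: "real^'k^'k" and u :: "real^'k"
  assumes M: "pos_def M" and N: "pos_def N"
  defines "x \<equiv> matrix_inv M *v u" and "w \<equiv> matrix_inv M *v u - matrix_inv N *v u"
  shows "N *v w = (N - M) *v x"
    and "u \<bullet> (matrix_inv N *v u) - u \<bullet> x + x \<bullet> ((N - M) *v x) = w \<bullet> (N *v w)"
proof -
  define p where "p = matrix_inv N *v u"
  have Mx: "M *v x = u" and Np: "N *v p = u"
    by (simp_all add: x_def p_def pos_def_inverse M N)
  have w: "w = x - p" by (simp add: w_def x_def p_def)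
  \<comment> \<open>Both \<open>M *v x\<close> and \<open>N *v p\<close> equal \<open>u\<close>, so
    subtracting \<open>u\<close> from \<open>N *v x\<close> gives either side.\<close>
  show Nw: "N *v w = (N - M) *v x"
    by (simp add: w matrix_vector_mult_diff_distrib matrix_vector_mult_diff_rdistrib Mx Np)
  have sym: "p \<bullet> (N *v x) = x \<bullet> u"
    using N by (simp add: pos_def_def symmetric_inner[of N p x] Np)
  show "u \<bullet> (matrix_inv N *v u) - u \<bullet> x + x \<bullet> ((N - M) *v x) = w \<bullet> (N *v w)"
    unfolding Nw unfolding p_def[symmetric]
    using sym by (simp add: w matrix_vector_mult_diff_rdistrib Mx inner_diff_left
        inner_diff_right inner_commute)
qed

section \<open>Convexity and Taylor remainder of the trace of F\<close>

locale psd_family =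
  fixes A :: "'m::finite \<Rightarrow> real^'n^'n"
    and B :: "real^'n^'l"
  assumes psd_A: "psd (A i)"
    and pos_def_one: "pos_def (lin_comb A 1)"
begin

text \<open>For \<open>x \<noteq> 0\<close> the forms \<open>x \<bullet> (A i *v x)\<close> are
  nonnegative with positive sum, so one of them is positive; positive weights keep the weighted sum
  positive.\<close>

lemma pos_def_lin_comb:
  assumes y: "\<And>i. 0 < y $ i"
  shows "pos_def (lin_comb A y)"
  unfolding pos_def_def
proof (intro conjI allI impI)
  have "A k $ i $ j = A k $ j $ i" for k i j
    using psd_A[of k] unfolding psd_def transpose_def by (metis vec_lambda_beta)
  then show "transpose (lin_comb A y) = lin_comb A y"
    by (simp add: lin_comb_def transpose_def vec_eq_iff)
next
  fix x :: "real^'n"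
  assume "x \<noteq> 0"
  then have "0 < (\<Sum>i\<in>UNIV. x \<bullet> (A i *v x))"
    using pos_def_one by (simp add: pos_def_def lin_comb_inner)
  then obtain i where "0 < x \<bullet> (A i *v x)"
    by (metis not_le sum_nonpos)
  then have "0 < (\<Sum>i\<in>UNIV. y $ i * (x \<bullet> (A i *v x)))"
    using y psd_inner_nonneg[OF psd_A]
    by (intro sum_pos2[of UNIV i]) (auto simp: less_imp_le)
  then show "0 < x \<bullet> (lin_comb A y *v x)"
    by (simp add: lin_comb_inner)
qed

lemma trace_F: "trace (F A B y) = (\<Sum>j\<in>UNIV. row j B \<bullet> (matrix_inv (lin_comb A y) *v row j B))"
  by (simp add: F_def trace_congruence)

text \<open>Symmetry of the inverse moves one factor to each side of \<open>A i\<close>. The result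
  has the shape of the first-order term in \<open>inverse_form_remainder\<close>.\<close>

lemma grad_trace_F_inner:
  assumes y: "\<And>i. 0 < y $ i"
  shows "grad_trace_F A B y \<bullet> v =
    - (\<Sum>j\<in>UNIV. (matrix_inv (lin_comb A y) *v row j B) \<bullet>
        (lin_comb A v *v (matrix_inv (lin_comb A y) *v row j B)))"
proof -
  let ?M = "lin_comb A y" and ?Q = "matrix_inv (lin_comb A y)"
  have M: "pos_def ?M" by (rule pos_def_lin_comb[OF y])
  have Q: "u \<bullet> (?Q *v a) = (?Q *v u) \<bullet> a" for u a
  proof -
    have "u \<bullet> (?Q *v a) = (?M *v (?Q *v u)) \<bullet> (?Q *v a)"
      by (simp add: pos_def_inverse M)
    also have "\<dots> = (?Q *v u) \<bullet> (?M *v (?Q *v a))"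
      using M by (metis inner_commute pos_def_def symmetric_inner)
    finally show ?thesis by (simp add: pos_def_inverse M)
  qed
  have "trace (B ** ?Q ** A i ** ?Q ** transpose B) =
      (\<Sum>j\<in>UNIV. (?Q *v row j B) \<bullet> (A i *v (?Q *v row j B)))" for i
    using trace_congruence[of B "?Q ** A i ** ?Q"]
    by (simp add: matrix_mul_assoc matrix_vector_mul_assoc[symmetric] Q)
  then have "grad_trace_F A B y \<bullet> v =
      - (\<Sum>i\<in>UNIV. \<Sum>j\<in>UNIV. v $ i * ((?Q *v row j B) \<bullet> (A i *v (?Q *v row j B))))"
    by (simp add: grad_trace_F_def inner_vec_def[of "vec_lambda _"] sum_negf sum_distrib_left mult.commute)
  also have "\<dots> = - (\<Sum>j\<in>UNIV. \<Sum>i\<in>UNIV. v $ i * ((?Q *v row j B) \<bullet> (A i *v (?Q *v row j B))))"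
    by (subst sum.swap) (rule refl)
  finally show ?thesis by (simp add: lin_comb_inner)
qed

text \<open>Summing \<open>inverse_form_remainder\<close> over the rows of \<open>B\<close> gives
  \<open>R\<close> as a sum of forms \<open>w \<bullet> (?N *v w)\<close>, which yields convexity.
  For the upper bound such a form is also \<open>w \<bullet> (lin_comb A (z - y) *v x)\<close>. Each
  of its summands splits into an \<open>x\<close> part, controlled relative to \<open>y\<close>, and
  a \<open>w\<close> part, controlled relative to \<open>z\<close>.\<close>

lemma trace_F_remainder:
  assumes y: "\<And>i. 0 < y $ i" and z: "\<And>i. 0 < z $ i"
  defines "R \<equiv> trace (F A B z) - trace (F A B y) - grad_trace_F A B y \<bullet> (z - y)"
  shows "0 \<le> R"
    and "\<lbrakk>0 < t; \<And>i. \<bar>z $ i - y $ i\<bar> \<le> t * y $ i; \<And>i. \<bar>z $ i - y $ i\<bar> \<le> t * z $ i\<rbrakk>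
      \<Longrightarrow> R \<le> t\<^sup>2 * trace (F A B y)"
proof -
  let ?M = "lin_comb A y" and ?N = "lin_comb A z"
  define x where "x j = matrix_inv ?M *v row j B" for j
  define w where "w j = x j - matrix_inv ?N *v row j B" for j
  have M: "pos_def ?M" and N: "pos_def ?N"
    by (simp_all add: pos_def_lin_comb y z)
  have Nw: "?N *v w j = lin_comb A (z - y) *v x j"
    and rem: "row j B \<bullet> (matrix_inv ?N *v row j B) - row j B \<bullet> x j
        + x j \<bullet> (lin_comb A (z - y) *v x j) = w j \<bullet> (?N *v w j)" for j
    using inverse_form_remainder[OF M N, of "row j B"]
    by (simp_all add: x_def w_def lin_comb_diff)
  have R: "R = (\<Sum>j\<in>UNIV. w j \<bullet> (?N *v w j))"
    by (simp add: R_def trace_F grad_trace_F_inner[OF y] rem[symmetric] x_def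
        sum.distrib sum_subtractf)
  show "0 \<le> R"
    unfolding R using N by (intro sum_nonneg) (metis inner_zero_left order.refl less_imp_le pos_def_def)
  assume t: "0 < t" and ty: "\<And>i. \<bar>z $ i - y $ i\<bar> \<le> t * y $ i"
    and tz: "\<And>i. \<bar>z $ i - y $ i\<bar> \<le> t * z $ i"
  have "w j \<bullet> (?N *v w j) \<le> t\<^sup>2 * (row j B \<bullet> x j)" for j
  proof -
    have AMGM: "2 * ((z $ i - y $ i) * (w j \<bullet> (A i *v x j)))
        \<le> t\<^sup>2 * (y $ i * (x j \<bullet> (A i *v x j))) + z $ i * (w j \<bullet> (A i *v w j))" for i
    proof -
      define h a b c where "h = z $ i - y $ i" and "a = x j \<bullet> (A i *v x j)"
        and "b = w j \<bullet> (A i *v x j)" and "c = w j \<bullet> (A i *v w j)"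
      have a0: "0 \<le> a" and c0: "0 \<le> c"
        by (simp_all add: a_def c_def psd_inner_nonneg psd_A)
      \<comment> \<open>Taking \<open>s = 1\<close> and \<open>s = -1\<close> covers both signs of
        \<open>b\<close>; scaling \<open>x j\<close> by \<open>t\<close> balances the two
        parts.\<close>
      have "0 \<le> t\<^sup>2 * a - 2 * (s * t) * b + s\<^sup>2 * c" for s
      proof -
        have "0 \<le> (t *\<^sub>R x j - s *\<^sub>R w j) \<bullet> (A i *v (t *\<^sub>R x j - s *\<^sub>R w j))"
          by (rule psd_inner_nonneg[OF psd_A])
        also have "\<dots> = t\<^sup>2 * a - 2 * (s * t) * b + s\<^sup>2 * c"
          using psd_symmetric[OF psd_A, of "x j" i "w j"]
          by (simp add: a_def b_def c_def matrix_vector_mult_diff_distrib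
              matrix_vector_mult_scaleR inner_diff_left inner_diff_right
              algebra_simps power2_eq_square)
        finally show ?thesis .
      qed
      from this[of 1] this[of "-1"] have "2 * t * \<bar>b\<bar> \<le> t\<^sup>2 * a + c"
        by (cases "0 \<le> b") auto
      then have "\<bar>h\<bar> * (2 * t * \<bar>b\<bar>) \<le> \<bar>h\<bar> * (t\<^sup>2 * a + c)"
        by (rule mult_left_mono) simp
      also have "\<dots> = \<bar>h\<bar> * (t\<^sup>2 * a) + \<bar>h\<bar> * c"
        by (simp add: distrib_left)
      \<comment> \<open>The bound relative to \<open>y\<close> is spent on the \<open>x\<close>
        part, the one relative to \<open>z\<close> on the \<open>w\<close> part; a common factor
        \<open>t\<close> then cancels.\<close>
      also have "\<dots> \<le> (t * y $ i) * (t\<^sup>2 * a) + (t * z $ i) * c"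
        using ty[of i] tz[of i] a0 c0
        by (intro add_mono mult_right_mono) (auto simp: h_def)
      finally have "t * (2 * (\<bar>h\<bar> * \<bar>b\<bar>)) \<le> t * (t\<^sup>2 * (y $ i * a) + z $ i * c)"
        by (simp add: algebra_simps)
      then have "2 * (\<bar>h\<bar> * \<bar>b\<bar>) \<le> t\<^sup>2 * (y $ i * a) + z $ i * c"
        using t by simp
      moreover have "h * b \<le> \<bar>h\<bar> * \<bar>b\<bar>"
        by (metis abs_ge_self abs_mult)
      ultimately show ?thesis
        by (simp add: h_def a_def b_def c_def)
    qed
    \<comment> \<open>The sum of the \<open>w\<close> parts is
      \<open>w j \<bullet> (?N *v w j)\<close> itself, so one of the two copies on the left absorbs
      it.\<close>
    have "2 * (w j \<bullet> (?N *v w j)) = (\<Sum>i\<in>UNIV. 2 * ((z $ i - y $ i) * (w j \<bullet> (A i *v x j))))"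
      by (simp add: Nw lin_comb_inner sum_distrib_left)
    also have "\<dots> \<le> (\<Sum>i\<in>UNIV. t\<^sup>2 * (y $ i * (x j \<bullet> (A i *v x j))) + z $ i * (w j \<bullet> (A i *v w j)))"
      by (intro sum_mono AMGM)
    also have "\<dots> = t\<^sup>2 * (x j \<bullet> (?M *v x j)) + w j \<bullet> (?N *v w j)"
      by (simp add: lin_comb_inner sum.distrib sum_distrib_left)
    also have "x j \<bullet> (?M *v x j) = row j B \<bullet> x j"
      by (simp add: x_def pos_def_inverse M inner_commute)
    finally show ?thesis by simp
  qed
  then show "R \<le> t\<^sup>2 * trace (F A B y)"
    by (simp add: R trace_F x_def sum_distrib_left sum_mono)
qed

lemma trace_F_nonneg:
  assumes y: "\<And>i. 0 < y $ i"
  shows "0 \<le> trace (F A B y)"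
proof -
  let ?M = "lin_comb A y" and ?Q = "matrix_inv (lin_comb A y)"
  have M: "pos_def ?M" by (rule pos_def_lin_comb[OF y])
  have "0 \<le> u \<bullet> (?Q *v u)" for u
  proof -
    have "0 \<le> (?Q *v u) \<bullet> (?M *v (?Q *v u))"
      using M by (metis inner_zero_left order.refl less_imp_le pos_def_def)
    then show ?thesis by (simp add: pos_def_inverse M inner_commute)
  qed
  then show ?thesis by (simp add: trace_F sum_nonneg)
qed

end

section \<open>Geometrically bounded sequences\<close>

lemma geometrically_bounded_tendsto_0:
  assumes "geometrically_bounded a"
  shows "a \<longlonglongrightarrow> 0"
proof -
  obtain C q where q: "0 < q" "q < 1" and a: "\<And>k. \<bar>a k\<bar> \<le> C * q ^ k"
    using assms by (auto simp: geometrically_bounded_def)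
  have "(\<lambda>k. C * q ^ k) \<longlonglongrightarrow> C * 0"
    using q by (intro tendsto_mult_left LIMSEQ_realpow_zero) auto
  then show ?thesis
    using a by (intro Lim_null_comparison[of a]) auto
qed

lemma geometrically_bounded_contraction:
  assumes q: "0 < q" "q < 1" and a0: "\<And>k. 0 \<le> a k" and step: "\<And>k. a (Suc k) \<le> q * a k"
  shows "geometrically_bounded a"
proof -
  have "a k \<le> a 0 * q ^ k" for k
  proof (induction k)
    case (Suc k)
    have "a (Suc k) \<le> q * a k" by (rule step)
    also have "\<dots> \<le> q * (a 0 * q ^ k)" using Suc q by (intro mult_left_mono) auto
    finally show ?case by (simp add: algebra_simps)
  qed simp
  then show ?thesis
    using q a0 unfolding geometrically_bounded_def
    by (intro exI[of _ "a 0"] exI[of _ q]) auto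
qed

lemma geometrically_bounded_dominated:
  assumes a: "geometrically_bounded a" and L: "0 \<le> L" and b: "\<And>k. \<bar>b k\<bar> \<le> L * a k"
  shows "geometrically_bounded b"
proof -
  obtain C q where q: "0 < q" "q < 1" and aC: "\<And>k. \<bar>a k\<bar> \<le> C * q ^ k"
    using a by (auto simp: geometrically_bounded_def)
  have "\<bar>b k\<bar> \<le> L * C * q ^ k" for k
  proof -
    have "\<bar>b k\<bar> \<le> L * a k" by (rule b)
    also have "\<dots> \<le> L * (C * q ^ k)"
      using aC[of k] L by (intro mult_left_mono) auto
    finally show ?thesis by (simp add: mult.assoc)
  qed
  then show ?thesis
    using q unfolding geometrically_bounded_def by blast
qed

lemma tendsto_infnorm_cart:
  fixes y :: "nat \<Rightarrow> real^'m"
  assumes "(\<lambda>k. infnorm (y k - l)) \<longlonglongrightarrow> 0"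
  shows "y \<longlonglongrightarrow> l"
proof (rule vec_tendstoI)
  fix i
  have "(\<lambda>k. y k $ i - l $ i) \<longlonglongrightarrow> 0"
    using assms component_le_infnorm_cart[of "y _ - l" i]
    by (intro Lim_null_comparison[OF _ assms]) auto
  then show "(\<lambda>k. y k $ i) \<longlonglongrightarrow> l $ i"
    by (simp add: LIM_zero_iff)
qed

section \<open>Residual, stability and decrease in one step\<close>

locale reconstruction = psd_family A B
  for A :: "'m::finite \<Rightarrow> real^'n^'n" and B :: "real^'n^'l" +
  fixes ylo yup yhat :: "real^'m" and L :: real
  assumes ylo_pos: "0 < ylo $ i"
    and yhat_box: "yhat \<in> {ylo..yup}"
    and L_pos: "0 < L"
    and stability: "y \<in> {ylo..yup} \<Longrightarrow>
      infnorm (y - yhat) \<le> L * spectral_norm (F A B y - F A B yhat)"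
begin

abbreviation "Y \<equiv> adm A B ylo yup yhat"
abbreviation "r \<equiv> res A B yhat"
abbreviation "g \<equiv> grad_trace_F A B"

definition "ymin = Min (range (\<lambda>i. ylo $ i))"
text \<open>Scales the error of the linear model: towards \<open>yhat\<close>, the predicted gain
  misses \<open>r y\<close> by at most the fraction \<open>c * r y\<close>.\<close>

definition "c = L\<^sup>2 * trace (F A B yhat) / ymin\<^sup>2"

lemma ymin_pos: "0 < ymin"
  by (simp add: ymin_def ylo_pos)

lemma box_ge_ymin: "y \<in> {ylo..yup} \<Longrightarrow> ymin \<le> y $ i"
  unfolding ymin_def
  by (rule order_trans[OF Min_le[of _ "ylo $ i"]]) (auto simp: less_eq_vec_def)

lemma box_pos: "y \<in> {ylo..yup} \<Longrightarrow> 0 < y $ i"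
  using box_ge_ymin[of y i] ymin_pos by simp

lemma adm_box: "y \<in> Y \<Longrightarrow> y \<in> {ylo..yup}"
  by (simp add: adm_def)

lemma yhat_adm: "yhat \<in> Y"
  using yhat_box by (simp add: adm_def loewner_le_def psd_def transpose_def vec_eq_iff)

lemma trace_yhat_nonneg: "0 \<le> trace (F A B yhat)"
  by (intro trace_F_nonneg box_pos yhat_box)

lemma c_nonneg: "0 \<le> c"
  using trace_yhat_nonneg by (simp add: c_def)

lemma res_trace: "r y = trace (F A B yhat) - trace (F A B y)"
  by (simp add: res_def trace_def sum_subtractf)

lemma res_nonneg: "y \<in> Y \<Longrightarrow> 0 \<le> r y"
  by (simp add: adm_def loewner_le_def res_def psd_trace_nonneg)

text \<open>Admissibility makes \<open>F A B yhat - F A B y\<close> semidefinite, so its spectral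
  norm is at most its trace \<open>r y\<close>. The sign change is harmless for the operator
  norm.\<close>

lemma infnorm_le_res:
  assumes y: "y \<in> Y"
  shows "infnorm (y - yhat) \<le> L * r y"
proof -
  have "spectral_norm (F A B y - F A B yhat) = spectral_norm (F A B yhat - F A B y)"
    unfolding spectral_norm_def
    using onorm_neg[of "\<lambda>x. F A B y *v x - F A B yhat *v x"]
    by (simp add: matrix_vector_mult_diff_rdistrib[abs_def])
  also have "\<dots> \<le> r y"
    using y by (simp add: adm_def loewner_le_def res_def spectral_norm_le_trace)
  finally have "L * spectral_norm (F A B y - F A B yhat) \<le> L * r y"
    using L_pos by simp
  then show ?thesis
    using stability[OF adm_box[OF y]] by linarith
qed

lemma res_pos:
  assumes y: "y \<in> Y" and ne: "y \<noteq> yhat"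
  shows "0 < r y"
proof -
  have "0 < infnorm (y - yhat)" using ne by (simp add: infnorm_pos_lt)
  then have "0 < L * r y" using infnorm_le_res[OF y] by linarith
  then show ?thesis using L_pos by (simp add: zero_less_mult_iff)
qed

text \<open>The upper remainder bound at \<open>z = yhat\<close>: the linear model predicts almost
  the whole residual as gain, up to an error quadratic in \<open>r y\<close>.\<close>

lemma gradient_gap:
  assumes y: "y \<in> Y" and ne: "y \<noteq> yhat"
  shows "r y * (1 - c * r y) \<le> g y \<bullet> (yhat - y)"
proof -
  \<comment> \<open>Chosen so that \<open>t * ymin = L * r y\<close>; since \<open>y\<close> and
    \<open>yhat\<close> are both at least \<open>ymin\<close>, both relative bounds hold.\<close>
  define t where "t = L * r y / ymin"
  have t: "0 < t"
    using res_pos[OF y ne] L_pos ymin_pos by (simp add: t_def)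
  have "\<bar>yhat $ i - y $ i\<bar> \<le> t * v $ i" if v: "v \<in> {ylo..yup}" for v i
  proof -
    have "\<bar>yhat $ i - y $ i\<bar> \<le> L * r y"
      using component_le_infnorm_cart[of "y - yhat" i] infnorm_le_res[OF y] by simp
    also have "\<dots> = t * ymin" using ymin_pos by (simp add: t_def)
    also have "\<dots> \<le> t * v $ i" using box_ge_ymin[OF v, of i] t by simp
    finally show ?thesis .
  qed
  note bound = this[OF adm_box[OF y]] this[OF yhat_box]
  have "trace (F A B yhat) - trace (F A B y) - g y \<bullet> (yhat - y) \<le> t\<^sup>2 * trace (F A B y)"
    by (intro trace_F_remainder(2) box_pos yhat_box adm_box y t bound)
  \<comment> \<open>A nonnegative residual replaces the trace at \<open>y\<close> by a
    constant.\<close>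
  also have "\<dots> \<le> t\<^sup>2 * trace (F A B yhat)"
    using res_nonneg[OF y] by (intro mult_left_mono) (auto simp: res_trace)
  also have "\<dots> = c * r y * r y"
    by (simp add: t_def c_def power_mult_distrib power_divide power2_eq_square)
  finally show ?thesis by (simp add: res_trace algebra_simps)
qed

text \<open>By convexity the true decrease is at least the gain of the linear model. The candidate
  secures the fraction \<theta> of \<open>z - g y \<bullet> y\<close>, which dominates the gain
  towards \<open>yhat\<close> because \<open>yhat\<close> is admissible.\<close>

lemma res_decrease:
  assumes y: "y \<in> Y" and ne: "y \<noteq> yhat" and y': "y' \<in> Y"
    and \<theta>: "0 < \<theta>" and z: "sdp_upper_bound Y (g y) z"
    and cand: "\<theta> * (z - g y \<bullet> y) \<le> g y \<bullet> (y' - y)"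
  shows "r y' \<le> (1 - \<theta> * (1 - c * r y)) * r y"
proof -
  have "0 \<le> trace (F A B y') - trace (F A B y) - g y \<bullet> (y' - y)"
    by (intro trace_F_remainder(1) box_pos adm_box y y')
  then have "r y' \<le> r y - g y \<bullet> (y' - y)"
    by (simp add: res_trace)
  also have "\<dots> \<le> r y - \<theta> * (z - g y \<bullet> y)"
    using cand by simp
  also have "\<dots> \<le> r y - \<theta> * (r y * (1 - c * r y))"
  proof -
    have "g y \<bullet> yhat \<le> z"
      using z yhat_adm by (simp add: sdp_upper_bound_def)
    then have "r y * (1 - c * r y) \<le> z - g y \<bullet> y"
      using gradient_gap[OF y ne] by (simp add: inner_diff_right)
    then show ?thesis using \<theta> by simp
  qed
  finally show ?thesis by (simp add: algebra_simps)
qed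

section \<open>Convergence of the iterates\<close>

lemma linear_convergence:
  assumes y: "\<And>k. y k \<in> Y" and q: "0 < q" "q < 1"
    and step: "\<And>k. r (y (Suc k)) \<le> q * r (y k)"
  shows "geometrically_bounded (\<lambda>k. r (y k))"
    and "geometrically_bounded (\<lambda>k. infnorm (y k - yhat))"
    and "(\<lambda>k. r (y k)) \<longlonglongrightarrow> 0" and "y \<longlonglongrightarrow> yhat"
proof -
  show gr: "geometrically_bounded (\<lambda>k. r (y k))"
    using q step by (intro geometrically_bounded_contraction[of q] res_nonneg y)
  show gi: "geometrically_bounded (\<lambda>k. infnorm (y k - yhat))"
    using L_pos infnorm_le_res[OF y]
    by (intro geometrically_bounded_dominated[OF gr, of L]) (auto simp: abs_of_nonneg infnorm_pos_le)
  show "(\<lambda>k. r (y k)) \<longlonglongrightarrow> 0"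
    by (rule geometrically_bounded_tendsto_0[OF gr])
  show "y \<longlonglongrightarrow> yhat"
    by (rule tendsto_infnorm_cart[OF geometrically_bounded_tendsto_0[OF gi]])
qed

text \<open>The starting threshold says \<open>c * r (y 0) < 1 - \<gamma>\<close>. It persists, in
  weak form, because the residuals do not increase, and this gives the factor
  \<open>1 - \<theta> * \<gamma>\<close>. Once the residuals tend to 0, the factors of
  \<open>res_decrease\<close> tend to \<open>1 - \<theta>\<close>.\<close>

lemma local_convergence:
  assumes \<theta>: "0 < \<theta>" "\<theta> < 1" and \<gamma>: "0 < \<gamma>" "\<gamma> < 1"
    and y: "\<And>k. y k \<in> Y" and ne: "\<And>k. y k \<noteq> yhat"
    and start: "r (y 0) < (1 - \<gamma>) * (ymin\<^sup>2 / (L\<^sup>2 * trace (F A B yhat)))"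
    and step: "\<And>k. \<exists>z. sdp_upper_bound Y (g (y k)) z \<and>
      \<theta> * (z - g (y k) \<bullet> y k) \<le> g (y k) \<bullet> (y (Suc k) - y k)"
  shows "r (y (Suc k)) \<le> (1 - \<theta> * \<gamma>) * r (y k)"
    and "limsup (\<lambda>k. ereal (r (y (Suc k)) / r (y k))) \<le> ereal (1 - \<theta>)"
proof -
  have pos: "0 < r (y k)" for k by (rule res_pos[OF y ne])
  have dec: "r (y (Suc k)) \<le> (1 - \<theta> * (1 - c * r (y k))) * r (y k)" for k
    using step[of k] res_decrease[OF y ne y \<theta>(1)] by blast
  \<comment> \<open>With trace 0, division by zero would make the threshold 0, contradicting the
    positive residual.\<close>
  have "trace (F A B yhat) \<noteq> 0"
    using start pos[of 0] by auto
  then have "0 < trace (F A B yhat)"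
    using trace_yhat_nonneg by simp
  then have "c * r (y 0) < 1 - \<gamma>"
    using start ymin_pos L_pos by (simp add: c_def field_simps)
  then have small: "c * r (y k) \<le> 1 - \<gamma>" for k
  proof (induction k)
    case (Suc k)
    then have "0 \<le> \<theta> * (1 - c * r (y k))"
      using \<theta> \<gamma> by (intro mult_nonneg_nonneg) auto
    then have "(1 - \<theta> * (1 - c * r (y k))) * r (y k) \<le> 1 * r (y k)"
      using pos[of k] by (intro mult_right_mono) auto
    then have "r (y (Suc k)) \<le> r (y k)"
      using dec[of k] by simp
    then have "c * r (y (Suc k)) \<le> c * r (y k)"
      using c_nonneg by (rule mult_left_mono)
    then show ?case using Suc by simp
  qed simp
  have contr: "r (y (Suc k)) \<le> (1 - \<theta> * \<gamma>) * r (y k)" for k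
  proof -
    have "\<theta> * \<gamma> \<le> \<theta> * (1 - c * r (y k))"
      using small[of k] \<theta> by simp
    then have "(1 - \<theta> * (1 - c * r (y k))) * r (y k) \<le> (1 - \<theta> * \<gamma>) * r (y k)"
      using pos[of k] by (intro mult_right_mono) auto
    then show ?thesis using dec[of k] by simp
  qed
  show "r (y (Suc k)) \<le> (1 - \<theta> * \<gamma>) * r (y k)" by (rule contr)
  have "\<theta> * \<gamma> < 1" "0 < \<theta> * \<gamma>"
    using \<theta> \<gamma> mult_strict_mono[of \<theta> 1 \<gamma> 1] by auto
  then have lim: "(\<lambda>k. r (y k)) \<longlonglongrightarrow> 0"
    using contr by (intro linear_convergence(3)[where q = "1 - \<theta> * \<gamma>"] y) auto
  have "(\<lambda>k. 1 - \<theta> * (1 - c * r (y k))) \<longlonglongrightarrow> 1 - \<theta> * (1 - c * 0)"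
    by (intro tendsto_intros lim)
  then have "limsup (\<lambda>k. ereal (1 - \<theta> * (1 - c * r (y k)))) = ereal (1 - \<theta>)"
    by (intro lim_imp_Limsup) simp_all
  moreover have "limsup (\<lambda>k. ereal (r (y (Suc k)) / r (y k)))
      \<le> limsup (\<lambda>k. ereal (1 - \<theta> * (1 - c * r (y k))))"
    using dec pos by (intro Limsup_mono always_eventually) (simp add: divide_le_eq)
  ultimately show "limsup (\<lambda>k. ereal (r (y (Suc k)) / r (y k))) \<le> ereal (1 - \<theta>)"
    by simp
qed

text \<open>If the solver reports failure, its bound still dominates the gain towards
  \<open>yhat\<close>, which is at least \<open>\<gamma> * r y\<close>, so the failure criterion is
  contradicted. A returned candidate contracts by \<open>1 - \<theta> * \<gamma>\<close>, hence
  passes the test with \<kappa>.\<close>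

lemma no_global_search_near_solution:
  assumes \<theta>: "0 < \<theta>" and \<kappa>: "1 - \<theta> * \<gamma> \<le> \<kappa>"
    and y: "y \<in> Y" and ne: "y \<noteq> yhat" and small: "c * r y \<le> 1 - \<gamma>"
    and out: "sdp_outcome Y (g y) \<gamma> \<theta> (r y) y z out"
  shows "\<not> needs_global_search r \<kappa> y out"
proof (cases out)
  case None
  have "g y \<bullet> yhat \<le> z"
    using out yhat_adm by (simp add: sdp_outcome_def sdp_upper_bound_def)
  moreover have "\<gamma> * r y \<le> r y * (1 - c * r y)"
    using small res_nonneg[OF y] by (subst mult.commute) (intro mult_left_mono, auto)
  ultimately have "\<gamma> * r y \<le> z - g y \<bullet> y"
    using gradient_gap[OF y ne] by (simp add: inner_diff_right)
  then show ?thesis using out None by (simp add: sdp_outcome_def)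
next
  case (Some v)
  have "r v \<le> (1 - \<theta> * (1 - c * r y)) * r y"
    using out Some by (intro res_decrease[OF y ne _ \<theta>, of _ z]) (simp_all add: sdp_outcome_def)
  also have "\<dots> \<le> \<kappa> * r y"
  proof -
    have "\<theta> * \<gamma> \<le> \<theta> * (1 - c * r y)"
      using small \<theta> by simp
    then show ?thesis using \<kappa> res_nonneg[OF y] by (intro mult_right_mono) auto
  qed
  finally show ?thesis using Some by (simp add: needs_global_search_def)
qed

end

section \<open>Local and global convergence of the method\<close>

theorem corollary11:
  fixes A :: "'m::finite \<Rightarrow> real^'n^'n"
    and B :: "real^'n^'l"
    and ylo yup yhat :: "real^'m"
    and \<delta> L \<gamma> \<theta> :: real
  assumes A_psd: "\<forall>i. A i \<noteq> 0 \<and> psd (A i)"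
    and A_one: "pos_def (lin_comb A 1)"
    and B_rank: "rank B = CARD('l)"
    and bounds: "\<forall>i. 0 < ylo $ i \<and> ylo $ i < yup $ i"
    and delta: "\<delta> > 0"
    and yhat: "yhat \<in> {ylo + \<delta> *\<^sub>R 1 .. yup - \<delta> *\<^sub>R 1}"
    and L_pos: "L > 0"
    and L_stab: "\<forall>y\<in>{ylo..yup}. \<forall>z\<in>{ylo..yup}.
                   infnorm (y - z) \<le> L * spectral_norm (F A B y - F A B z)"
    and gamma: "0 < \<gamma>" "\<gamma> < 1"
    and theta: "0 < \<theta>" "\<theta> < 1"
  shows
    "(\<forall>y :: nat \<Rightarrow> real^'m.
        y 0 \<in> adm A B ylo yup yhat \<and>
        res A B yhat (y 0)
          < (1 - \<gamma>) * ((Min (range (\<lambda>i. ylo $ i)))\<^sup>2 / (L\<^sup>2 * trace (F A B yhat))) \<and>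
        (\<forall>k. (\<forall>j\<le>k. y j \<noteq> yhat) \<longrightarrow>
           y (Suc k) \<in> adm A B ylo yup yhat \<and>
           (\<exists>z. sdp_upper_bound (adm A B ylo yup yhat) (grad_trace_F A B (y k)) z \<and>
                grad_trace_F A B (y k) \<bullet> (y (Suc k) - y k)
                  \<ge> \<theta> * (z - grad_trace_F A B (y k) \<bullet> y k)))
        \<longrightarrow>
        (\<exists>k. y k = yhat) \<or>
        ((\<forall>k. y k \<noteq> yhat \<and> res A B yhat (y k) > 0) \<and>
         (\<lambda>k. res A B yhat (y k)) \<longlonglongrightarrow> 0 \<and>
         (SUP k. ereal (res A B yhat (y (Suc k)) / res A B yhat (y k))) \<le> ereal (1 - \<theta> * \<gamma>) \<and>
         1 - \<theta> * \<gamma> < 1 \<and>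
         limsup (\<lambda>k. ereal (res A B yhat (y (Suc k)) / res A B yhat (y k))) \<le> ereal (1 - \<theta>) \<and>
         1 - \<theta> < 1 \<and>
         y \<longlonglongrightarrow> yhat \<and>
         geometrically_bounded (\<lambda>k. infnorm (y k - yhat))))
     \<and>
     (\<forall>(\<kappa>::real) (y :: nat \<Rightarrow> real^'m) (z :: nat \<Rightarrow> real) (out :: nat \<Rightarrow> (real^'m) option).
        1 - \<theta> * \<gamma> < \<kappa> \<and> \<kappa> < 1 \<and>
        globalized_run A B ylo yup yhat \<gamma> \<theta> \<kappa> y z out
        \<longrightarrow>
        (\<exists>k. y k = yhat) \<or>
        ((\<forall>k. y k \<noteq> yhat) \<and>
         (\<lambda>k. res A B yhat (y k)) \<longlonglongrightarrow> 0 \<and>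
         geometrically_bounded (\<lambda>k. res A B yhat (y k)) \<and>
         y \<longlonglongrightarrow> yhat \<and>
         geometrically_bounded (\<lambda>k. infnorm (y k - yhat)) \<and>
         finite {k. needs_global_search (res A B yhat) \<kappa> (y k) (out k)}))"
proof (intro conjI allI impI)
  have "yhat \<in> {ylo..yup}"
    using yhat delta by (simp add: less_eq_vec_def) (smt (verit, best))
  then interpret reconstruction A B ylo yup yhat L
    using A_psd A_one bounds L_pos L_stab by unfold_locales auto
  have \<theta>\<gamma>: "0 < \<theta> * \<gamma>" "\<theta> * \<gamma> < 1"
    using theta gamma mult_strict_mono[of \<theta> 1 \<gamma> 1] by auto
  {
    fix y :: "nat \<Rightarrow> real^'m"
    assume H: "y 0 \<in> Y \<and>
      r (y 0) < (1 - \<gamma>) * ((Min (range (\<lambda>i. ylo $ i)))\<^sup>2 / (L\<^sup>2 * trace (F A B yhat))) \<and>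
      (\<forall>k. (\<forall>j\<le>k. y j \<noteq> yhat) \<longrightarrow> y (Suc k) \<in> Y \<and>
        (\<exists>z. sdp_upper_bound Y (g (y k)) z \<and> g (y k) \<bullet> (y (Suc k) - y k) \<ge> \<theta> * (z - g (y k) \<bullet> y k)))"
    show "(\<exists>k. y k = yhat) \<or>
        ((\<forall>k. y k \<noteq> yhat \<and> r (y k) > 0) \<and> (\<lambda>k. r (y k)) \<longlonglongrightarrow> 0 \<and>
         (SUP k. ereal (r (y (Suc k)) / r (y k))) \<le> ereal (1 - \<theta> * \<gamma>) \<and> 1 - \<theta> * \<gamma> < 1 \<and>
         limsup (\<lambda>k. ereal (r (y (Suc k)) / r (y k))) \<le> ereal (1 - \<theta>) \<and> 1 - \<theta> < 1 \<and>
         y \<longlonglongrightarrow> yhat \<and> geometrically_bounded (\<lambda>k. infnorm (y k - yhat)))"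
    proof (subst disj_imp, rule impI)
      assume "\<nexists>k. y k = yhat"
      \<comment> \<open>Both update rules are guaranteed only before \<open>yhat\<close> is reached,
        so this makes them available for every \<open>k\<close>.\<close>
      then have ne: "y k \<noteq> yhat" for k by blast
      have y: "y k \<in> Y" for k
        using H ne by (cases k) auto
      have start: "r (y 0) < (1 - \<gamma>) * (ymin\<^sup>2 / (L\<^sup>2 * trace (F A B yhat)))"
        using H by (simp add: ymin_def)
      have step: "\<exists>z. sdp_upper_bound Y (g (y k)) z \<and>
          \<theta> * (z - g (y k) \<bullet> y k) \<le> g (y k) \<bullet> (y (Suc k) - y k)" for k
        using H ne by blast
      note lc = local_convergence[OF theta gamma y ne start step]
      have pos: "0 < r (y k)" for k by (rule res_pos[OF y ne])
      have "(SUP k. ereal (r (y (Suc k)) / r (y k))) \<le> ereal (1 - \<theta> * \<gamma>)"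
        using lc(1) pos by (intro SUP_least) (simp add: divide_le_eq)
      then show "(\<forall>k. y k \<noteq> yhat \<and> r (y k) > 0) \<and> (\<lambda>k. r (y k)) \<longlonglongrightarrow> 0 \<and>
         (SUP k. ereal (r (y (Suc k)) / r (y k))) \<le> ereal (1 - \<theta> * \<gamma>) \<and> 1 - \<theta> * \<gamma> < 1 \<and>
         limsup (\<lambda>k. ereal (r (y (Suc k)) / r (y k))) \<le> ereal (1 - \<theta>) \<and> 1 - \<theta> < 1 \<and>
         y \<longlonglongrightarrow> yhat \<and> geometrically_bounded (\<lambda>k. infnorm (y k - yhat))"
        using linear_convergence[of y "1 - \<theta> * \<gamma>", OF y _ _ lc(1)] lc(2) ne pos \<theta>\<gamma> theta
        by simp
    qed
  next
    fix \<kappa> :: real and y :: "nat \<Rightarrow> real^'m" and z :: "nat \<Rightarrow> real"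
      and out :: "nat \<Rightarrow> (real^'m) option"
    assume H: "1 - \<theta> * \<gamma> < \<kappa> \<and> \<kappa> < 1 \<and> globalized_run A B ylo yup yhat \<gamma> \<theta> \<kappa> y z out"
    show "(\<exists>k. y k = yhat) \<or>
        ((\<forall>k. y k \<noteq> yhat) \<and> (\<lambda>k. r (y k)) \<longlonglongrightarrow> 0 \<and> geometrically_bounded (\<lambda>k. r (y k)) \<and>
         y \<longlonglongrightarrow> yhat \<and> geometrically_bounded (\<lambda>k. infnorm (y k - yhat)) \<and>
         finite {k. needs_global_search r \<kappa> (y k) (out k)})"
    proof (subst disj_imp, rule impI)
      assume "\<nexists>k. y k = yhat"
      then have ne: "y k \<noteq> yhat" for k by blast
      have y0: "y 0 \<in> Y"
        and outcome: "sdp_outcome Y (g (y k)) \<gamma> \<theta> (r (y k)) (y k) (z k) (out k)"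
        and update: "if needs_global_search r \<kappa> (y k) (out k)
          then y (Suc k) \<in> Y \<and> r (y (Suc k)) \<le> \<kappa> * r (y k) else y (Suc k) = the (out k)" for k
        using H ne by (auto simp: globalized_run_def)
      \<comment> \<open>An output \<open>None\<close> forces a global search, so
        \<open>the (out k)\<close> is read only for an accepted candidate, which is admissible and
        has passed the test with \<kappa>.\<close>
      have succ: "y (Suc k) \<in> Y \<and> r (y (Suc k)) \<le> \<kappa> * r (y k)" for k
        using outcome[of k] update[of k]
        by (cases "out k") (auto simp: needs_global_search_def sdp_outcome_def split: if_splits)
      have y: "y k \<in> Y" for k
        using y0 succ by (cases k) auto
      have \<kappa>: "0 < \<kappa>" "\<kappa> < 1" using H \<theta>\<gamma> by auto
      have contr: "r (y (Suc k)) \<le> \<kappa> * r (y k)" for k using succ by blast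
      note conv = linear_convergence[of y \<kappa>, OF y \<kappa> contr]
      \<comment> \<open>Contraction by \<kappa> in every step, however it was obtained, eventually
        brings the iterates into the region where no global search can occur.\<close>
      have "(\<lambda>k. c * r (y k)) \<longlonglongrightarrow> c * 0"
        by (intro tendsto_mult_left conv)
      then have "\<forall>\<^sub>F k in sequentially. c * r (y k) < 1 - \<gamma>"
        using gamma by (intro order_tendstoD) auto
      then have "\<forall>\<^sub>F k in sequentially. \<not> needs_global_search r \<kappa> (y k) (out k)"
      proof eventually_elim
        case (elim k)
        then show ?case
          using H theta by (intro no_global_search_near_solution[OF _ _ y ne _ outcome]) auto
      qed
      then have "finite {k. needs_global_search r \<kappa> (y k) (out k)}"
        by (simp add: cofinite_eq_sequentially[symmetric] eventually_cofinite)
      then show "(\<forall>k. y k \<noteq> yhat) \<and> (\<lambda>k. r (y k)) \<longlonglongrightarrow> 0 \<and> geometrically_bounded (\<lambda>k. r (y k)) \<and>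
         y \<longlonglongrightarrow> yhat \<and> geometrically_bounded (\<lambda>k. infnorm (y k - yhat)) \<and>
         finite {k. needs_global_search r \<kappa> (y k) (out k)}"
        using conv ne by simp
    qed
  }
qed

end
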